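(* Let $\mathcal P=\langle X:\mathcal R\rangle$ be a group presentation with reduced Squier complex $\mathrm{Sq}^{\rho}(\mathcal P)$. Then the subset $\operatorname{star}_1(\pi(\mathrm{Sq}^{\rho}(\mathcal P),F(X)))$ of the fundamental groupoid is a group under the binary operation $*$, and the restriction of the range map is a crossed module $$\mathbf r:\operatorname{star}_1(\pi(\mathrm{Sq}^{\rho}(\mathcal P),F(X)))\to F(X).$$
   Context: A group presentation $\mathcal P=\langle X:\mathcal R\rangle$ consists of a set $X$ and a set $\mathcal R\subseteq A^*\times A^*$ of pairs of words, where $A=X\cup X^{-1}$ and $A^*$ is the free monoid on $A$. $F(X)$ is the free group on $X$. The canonical map $\rho:A^*\to F(X)$ is suppressed: for $p,q\in F(X)$ and $(l,r)\in\mathcal R$, $plq$ and $prq$ denote $p(l\rho)q,\ p(r\rho)q\in F(X)$. Reduced Squier complex $\mathrm{Sq}^{\rho}(\mathcal P)$: the 2-complex with vertex set $F(X)$; one edge $(p,l,r,q)$ for each $p,q\in F(X)$ and $(l,r)\in\mathcal R$, starting at $plq$ and ending at $prq$; and, for all $p,q,p',q'\in F(X)$ and $(l,r),(l',r')\in\mathcal R$, a 2-cell making the edge paths $(p,l,r,qp'l'q')\circ(prqp',l',r',q')$ and $(plqp',l',r',q')\circ(p,l,r,qp'r'q')$ homotopic. $\pi(\mathrm{Sq}^{\rho}(\mathcal P),F(X))$ is its fundamental groupoid: vertex set $F(X)$, morphisms the homotopy classes (relative to endpoints) of edge paths (which may traverse edges backwards), composed by concatenation $\circ$. The domain and range of a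 morphism $\alpha$ are written $\alpha\mathbf d$ and $\alpha\mathbf r$. $\operatorname{star}_1$ is the set of morphisms with domain $1\in F(X)$. The group $F(X)$ acts on the left and right of this groupoid by the actions induced by $u\triangleright(p,l,r,q)=(up,l,r,q)$ and $(p,l,r,q)\triangleleft v=(p,l,r,qv)$ on edges (extended edge by edge to paths and then to homotopy classes). The operation $*$ is $$\alpha*\beta=(\alpha\triangleleft\beta\mathbf d)\circ(\alpha\mathbf r\triangleright\beta).$$ The action of $F(X)$ is $\alpha^q=q^{-1}\triangleright\alpha\triangleleft q$ for $q\in F(X)$. A crossed module is a group homomorphism $\partial:T\to\Gamma$ with an action $(t,g)\mapsto t^g$ of $\Gamma$ on $T$ (by automorphisms, on the right) such that $(t^g)\partial=g^{-1}(t\partial)g$ and $t^{u\partial}=u^{-1}tu$ for all $t,u\in T$, $g\in\Gamma$. Maps are written on the right. *)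

theory Defs
  imports "HOL-Algebra.Group"
begin

section \<open>Free groups\<close>

text \<open>
  A letter \<open>(x, True)\<close> stands for \<open>x\<close> and \<open>(x, False)\<close> for the formal inverse of \<open>x\<close>, so that
  \<open>X \<times> UNIV\<close> is the disjoint union of \<open>X\<close> and its set of formal inverses.
\<close>

type_synonym 'x word = "('x \<times> bool) list"

definition words :: "'x set \<Rightarrow> 'x word set" where
  "words X = lists (X \<times> UNIV)"

inductive cancels :: "'x set \<Rightarrow> 'x word \<Rightarrow> 'x word \<Rightarrow> bool" for X where
  "\<lbrakk>u \<in> words X; v \<in> words X; x \<in> X\<rbrakk> \<Longrightarrow> cancels X (u @ [(x, b), (x, \<not> b)] @ v) (u @ v)"

definition free_rel :: "'x set \<Rightarrow> ('x word \<times> 'x word) set" where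
  "free_rel X = {(u, v). u \<in> words X \<and> v \<in> words X \<and> equivclp (cancels X) u v}"

definition word_class :: "'x set \<Rightarrow> 'x word \<Rightarrow> 'x word set" where
  "word_class X w = free_rel X `` {w}"

definition free_group :: "'x set \<Rightarrow> 'x word set monoid" where
  "free_group X =
     \<lparr>carrier = words X // free_rel X,
      mult = (\<lambda>P Q. \<Union>u\<in>P. \<Union>v\<in>Q. word_class X (u @ v)),
      one = word_class X []\<rparr>"

lemma words_append: "u @ v \<in> words X \<longleftrightarrow> u \<in> words X \<and> v \<in> words X"
  by (auto simp: words_def)

lemma free_rel_equiv: "equiv (words X) (free_rel X)"
proof (rule equivI)
  show "free_rel X \<subseteq> words X \<times> words X"
    by (auto simp: free_rel_def)
  show "refl_on (words X) (free_rel X)"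
    by (auto simp: refl_on_def free_rel_def)
  show "Relation.sym (free_rel X)"
    by (auto simp: Relation.sym_def free_rel_def intro: equivclp_sym)
  show "Relation.trans (free_rel X)"
    by (auto simp: Relation.trans_def free_rel_def intro: equivclp_trans)
qed

lemma cancels_append:
  assumes "cancels X u u'" "a \<in> words X" "b \<in> words X"
  shows "cancels X (a @ u @ b) (a @ u' @ b)"
  using assms(1)
proof cases
  case (1 s t x c)
  have "cancels X ((a @ s) @ [(x, c), (x, \<not> c)] @ (t @ b)) ((a @ s) @ (t @ b))"
    using 1 assms by (intro cancels.intros) (auto simp: words_append)
  then show ?thesis using 1 by simp
qed

lemma equivclp_cancels_append:
  assumes "equivclp (cancels X) u u'" "a \<in> words X" "b \<in> words X"
  shows "equivclp (cancels X) (a @ u @ b) (a @ u' @ b)"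
  using assms(1)
proof (induction rule: equivclp_induct)
  case (step y z)
  have "equivclp (cancels X) (a @ y @ b) (a @ z @ b)"
    using step(2) cancels_append[OF _ assms(2,3)]
    by (meson r_into_equivclp equivclp_sym)
  then show ?case using step equivclp_trans by metis
qed simp

lemma free_rel_append:
  assumes "(u, u') \<in> free_rel X" "(v, v') \<in> free_rel X"
  shows "(u @ v, u' @ v') \<in> free_rel X"
proof -
  have w: "u \<in> words X" "u' \<in> words X" "v \<in> words X" "v' \<in> words X"
    using assms by (auto simp: free_rel_def)
  have n: "[] \<in> words X" by (simp add: words_def)
  have "equivclp (cancels X) (u @ v) (u' @ v)"
    using equivclp_cancels_append[of X u u' "[]" v] assms w n by (simp add: free_rel_def)
  moreover have "equivclp (cancels X) (u' @ v) (u' @ v')"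
    using equivclp_cancels_append[of X v v' "u'" "[]"] assms w n by (simp add: free_rel_def)
  ultimately show ?thesis
    using w equivclp_trans by (fastforce simp: free_rel_def words_append)
qed

lemma word_class_eq_iff:
  "\<lbrakk>u \<in> words X; v \<in> words X\<rbrakk> \<Longrightarrow> word_class X u = word_class X v \<longleftrightarrow> (u, v) \<in> free_rel X"
  unfolding word_class_def using eq_equiv_class_iff[OF free_rel_equiv] by fastforce

lemma free_group_carrier: "carrier (free_group X) = word_class X ` words X"
  by (auto simp: free_group_def word_class_def quotient_def)

lemma free_group_one: "\<one>\<^bsub>free_group X\<^esub> = word_class X []"
  by (simp add: free_group_def)

lemma free_group_mult:
  assumes "u \<in> words X" "v \<in> words X"
  shows "word_class X u \<otimes>\<^bsub>free_group X\<^esub> word_class X v = word_class X (u @ v)"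
proof -
  have eq: "word_class X (u' @ v') = word_class X (u @ v)"
    if "u' \<in> word_class X u" "v' \<in> word_class X v" for u' v'
  proof -
    have r: "(u, u') \<in> free_rel X" "(v, v') \<in> free_rel X"
      using that by (auto simp: word_class_def)
    have "(u @ v, u' @ v') \<in> free_rel X" by (rule free_rel_append[OF r])
    then show ?thesis
      unfolding word_class_def using equiv_class_eq[OF free_rel_equiv] by metis
  qed
  have "u \<in> word_class X u" "v \<in> word_class X v"
    using assms by (auto simp: word_class_def free_rel_def)
  then have "(\<Union>u'\<in>word_class X u. \<Union>v'\<in>word_class X v. word_class X (u' @ v')) = word_class X (u @ v)"
    using eq by blast
  then show ?thesis by (simp add: free_group_def)
qed

lemma free_group_group: "group (free_group X)"
proof (rule groupI)
  have n: "[] \<in> words X" by (simp add: words_def)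
  show "\<one>\<^bsub>free_group X\<^esub> \<in> carrier (free_group X)"
    using n by (auto simp: free_group_carrier free_group_one)
  fix x assume "x \<in> carrier (free_group X)"
  then obtain u where u: "u \<in> words X" "x = word_class X u"
    by (auto simp: free_group_carrier)
  show "\<one>\<^bsub>free_group X\<^esub> \<otimes>\<^bsub>free_group X\<^esub> x = x"
    using u n by (simp add: free_group_one free_group_mult)
  have "\<exists>v\<in>words X. (v @ u, []) \<in> free_rel X"
    using u(1)
  proof (induction u)
    case Nil
    then show ?case using n by (intro bexI[of _ "[]"]) (auto simp: free_rel_def)
  next
    case (Cons a u)
    obtain x b where a: "a = (x, b)" by (cases a)
    have x: "x \<in> X" and u: "u \<in> words X" using Cons.prems a by (auto simp: words_def)
    then obtain v where v: "v \<in> words X" "(v @ u, []) \<in> free_rel X" using Cons.IH by blast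
    have "cancels X (v @ [(x, \<not> b), (x, \<not> \<not> b)] @ u) (v @ u)"
      using v u x by (intro cancels.intros)
    then have "equivclp (cancels X) ((v @ [(x, \<not> b)]) @ a # u) (v @ u)"
      using a by (simp add: r_into_equivclp)
    moreover have "equivclp (cancels X) (v @ u) []"
      using v by (simp add: free_rel_def)
    ultimately have "equivclp (cancels X) ((v @ [(x, \<not> b)]) @ a # u) []"
      by (rule equivclp_trans)
    moreover have "v @ [(x, \<not> b)] \<in> words X" using v x by (auto simp: words_def)
    ultimately show ?case
      using Cons.prems n by (intro bexI[of _ "v @ [(x, \<not> b)]"])
        (auto simp: free_rel_def words_append simp del: append_assoc)
  qed
  then obtain v where v: "v \<in> words X" "(v @ u, []) \<in> free_rel X" by blast
  then have "word_class X v \<otimes>\<^bsub>free_group X\<^esub> x = \<one>\<^bsub>free_group X\<^esub>"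
    using u n by (simp add: free_group_one free_group_mult word_class_eq_iff words_append)
  then show "\<exists>y\<in>carrier (free_group X). y \<otimes>\<^bsub>free_group X\<^esub> x = \<one>\<^bsub>free_group X\<^esub>"
    using v by (auto simp: free_group_carrier)
qed (auto simp: free_group_carrier free_group_mult words_append)

definition group_presentation :: "'x set \<Rightarrow> ('x word \<times> 'x word) set \<Rightarrow> bool" where
  "group_presentation X R \<longleftrightarrow> R \<subseteq> words X \<times> words X"


section \<open>2-complexes and their fundamental groupoids\<close>

text \<open>
  An edge path \<open>(u, es, v)\<close> carries its end points explicitly, so that there is one empty path
  for each vertex. A pair \<open>(e, True)\<close> is the edge \<open>e\<close> traversed forwards, \<open>(e, False)\<close> the edge
  traversed backwards. A 2-cell is given by a pair of parallel edge paths, which it makes homotopic.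
\<close>

type_synonym ('v, 'e) epath = "'v \<times> ('e \<times> bool) list \<times> 'v"

record ('v, 'e) complex2 =
  verts :: "'v set"
  edges :: "'e set"
  src :: "'e \<Rightarrow> 'v"
  tgt :: "'e \<Rightarrow> 'v"
  cells :: "(('v, 'e) epath \<times> ('v, 'e) epath) set"

definition sedge_start :: "('v, 'e) complex2 \<Rightarrow> 'e \<times> bool \<Rightarrow> 'v" where
  "sedge_start K = (\<lambda>(e, b). if b then src K e else tgt K e)"

definition sedge_end :: "('v, 'e) complex2 \<Rightarrow> 'e \<times> bool \<Rightarrow> 'v" where
  "sedge_end K = (\<lambda>(e, b). if b then tgt K e else src K e)"

fun walk :: "('v, 'e) complex2 \<Rightarrow> 'v \<Rightarrow> ('e \<times> bool) list \<Rightarrow> 'v \<Rightarrow> bool" where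
  "walk K u [] v \<longleftrightarrow> u \<in> verts K \<and> u = v"
| "walk K u (e # es) v \<longleftrightarrow>
     u \<in> verts K \<and> fst e \<in> edges K \<and> u = sedge_start K e \<and> walk K (sedge_end K e) es v"

definition epaths :: "('v, 'e) complex2 \<Rightarrow> ('v, 'e) epath set" where
  "epaths K = {(u, es, v). walk K u es v}"

fun epath_start :: "('v, 'e) epath \<Rightarrow> 'v" where
  "epath_start (u, es, v) = u"

fun epath_end :: "('v, 'e) epath \<Rightarrow> 'v" where
  "epath_end (u, es, v) = v"

fun epath_comp :: "('v, 'e) epath \<Rightarrow> ('v, 'e) epath \<Rightarrow> ('v, 'e) epath" where
  "epath_comp (u, es, v) (v', es', w) = (u, es @ es', w)"

definition is_complex2 :: "('v, 'e) complex2 \<Rightarrow> bool" where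
  "is_complex2 K \<longleftrightarrow>
     src K ` edges K \<subseteq> verts K \<and> tgt K ` edges K \<subseteq> verts K \<and>
     (\<forall>(p, q) \<in> cells K. p \<in> epaths K \<and> q \<in> epaths K \<and>
        epath_start p = epath_start q \<and> epath_end p = epath_end q)"

inductive homotopic :: "('v, 'e) complex2 \<Rightarrow> ('v, 'e) epath \<Rightarrow> ('v, 'e) epath \<Rightarrow> bool"
  for K where
  refl: "p \<in> epaths K \<Longrightarrow> homotopic K p p"
| sym: "homotopic K p q \<Longrightarrow> homotopic K q p"
| trans: "\<lbrakk>homotopic K p q; homotopic K q r\<rbrakk> \<Longrightarrow> homotopic K p r"
| comp: "\<lbrakk>homotopic K p p'; homotopic K q q'; epath_end p = epath_start q\<rbrakk>
    \<Longrightarrow> homotopic K (epath_comp p q) (epath_comp p' q')"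
| cancel: "\<lbrakk>e \<in> edges K; v = sedge_start K (e, b)\<rbrakk>
    \<Longrightarrow> homotopic K (v, [(e, b), (e, \<not> b)], v) (v, [], v)"
| cell: "(p, q) \<in> cells K \<Longrightarrow> homotopic K p q"

definition homotopy_class :: "('v, 'e) complex2 \<Rightarrow> ('v, 'e) epath \<Rightarrow> ('v, 'e) epath set" where
  "homotopy_class K p = {q. homotopic K p q}"

definition groupoid_mors :: "('v, 'e) complex2 \<Rightarrow> ('v, 'e) epath set set" where
  "groupoid_mors K = homotopy_class K ` epaths K"

definition mor_dom :: "('v, 'e) epath set \<Rightarrow> 'v" where
  "mor_dom \<alpha> = the_elem (epath_start ` \<alpha>)"

definition mor_ran :: "('v, 'e) epath set \<Rightarrow> 'v" where
  "mor_ran \<alpha> = the_elem (epath_end ` \<alpha>)"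

definition mor_comp ::
  "('v, 'e) complex2 \<Rightarrow> ('v, 'e) epath set \<Rightarrow> ('v, 'e) epath set \<Rightarrow> ('v, 'e) epath set" where
  "mor_comp K \<alpha> \<beta> =
     (\<Union>p\<in>\<alpha>. \<Union>q\<in>{q \<in> \<beta>. epath_end p = epath_start q}. homotopy_class K (epath_comp p q))"

definition star :: "('v, 'e) complex2 \<Rightarrow> 'v \<Rightarrow> ('v, 'e) epath set set" where
  "star K v = {\<alpha> \<in> groupoid_mors K. mor_dom \<alpha> = v}"

fun map_epath :: "('v \<Rightarrow> 'w) \<Rightarrow> ('e \<Rightarrow> 'f) \<Rightarrow> ('v, 'e) epath \<Rightarrow> ('w, 'f) epath" where
  "map_epath f g (u, es, v) = (f u, map (\<lambda>(e, b). (g e, b)) es, f v)"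

definition map_mor ::
  "('w, 'f) complex2 \<Rightarrow> ('v \<Rightarrow> 'w) \<Rightarrow> ('e \<Rightarrow> 'f) \<Rightarrow> ('v, 'e) epath set \<Rightarrow> ('w, 'f) epath set" where
  "map_mor K f g \<alpha> = (\<Union>p\<in>\<alpha>. homotopy_class K (map_epath f g p))"


section \<open>The reduced Squier complex\<close>

type_synonym 'x squier_edge = "'x word set \<times> 'x word \<times> 'x word \<times> 'x word set"
type_synonym 'x squier_mor = "('x word set, 'x squier_edge) epath set"

definition squier_src :: "'x set \<Rightarrow> 'x squier_edge \<Rightarrow> 'x word set" where
  "squier_src X =
     (\<lambda>(p, l, r, q). p \<otimes>\<^bsub>free_group X\<^esub> word_class X l \<otimes>\<^bsub>free_group X\<^esub> q)"

definition squier_tgt :: "'x set \<Rightarrow> 'x squier_edge \<Rightarrow> 'x word set" where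
  "squier_tgt X =
     (\<lambda>(p, l, r, q). p \<otimes>\<^bsub>free_group X\<^esub> word_class X r \<otimes>\<^bsub>free_group X\<^esub> q)"

definition squier_step :: "'x set \<Rightarrow> 'x squier_edge \<Rightarrow> ('x word set, 'x squier_edge) epath" where
  "squier_step X e = (squier_src X e, [(e, True)], squier_tgt X e)"

definition squier_cells ::
  "'x set \<Rightarrow> ('x word \<times> 'x word) set \<Rightarrow>
     (('x word set, 'x squier_edge) epath \<times> ('x word set, 'x squier_edge) epath) set" where
  "squier_cells X R =
     (let F = free_group X; c = word_class X; s = squier_step X in
      {(epath_comp (s (p, l, r, q \<otimes>\<^bsub>F\<^esub> p' \<otimes>\<^bsub>F\<^esub> c l' \<otimes>\<^bsub>F\<^esub> q'))
                   (s (p \<otimes>\<^bsub>F\<^esub> c r \<otimes>\<^bsub>F\<^esub> q \<otimes>\<^bsub>F\<^esub> p', l', r', q')),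
        epath_comp (s (p \<otimes>\<^bsub>F\<^esub> c l \<otimes>\<^bsub>F\<^esub> q \<otimes>\<^bsub>F\<^esub> p', l', r', q'))
                   (s (p, l, r, q \<otimes>\<^bsub>F\<^esub> p' \<otimes>\<^bsub>F\<^esub> c r' \<otimes>\<^bsub>F\<^esub> q')))
       | p q p' q' l r l' r'.
         p \<in> carrier F \<and> q \<in> carrier F \<and> p' \<in> carrier F \<and> q' \<in> carrier F \<and>
         (l, r) \<in> R \<and> (l', r') \<in> R})"

definition squier_complex ::
  "'x set \<Rightarrow> ('x word \<times> 'x word) set \<Rightarrow> ('x word set, 'x squier_edge) complex2" where
  "squier_complex X R =
     \<lparr>verts = carrier (free_group X),
      edges = {(p, l, r, q). p \<in> carrier (free_group X) \<and> q \<in> carrier (free_group X) \<and> (l, r) \<in> R},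
      src = squier_src X,
      tgt = squier_tgt X,
      cells = squier_cells X R\<rparr>"

lemma squier_complex_wf:
  assumes "group_presentation X R"
  shows "is_complex2 (squier_complex X R)"
proof -
  interpret F: group "free_group X" by (rule free_group_group)
  have c: "word_class X l \<in> carrier (free_group X)" "word_class X r \<in> carrier (free_group X)"
    if "(l, r) \<in> R" for l r
    using assms that by (auto simp: group_presentation_def free_group_carrier)
  show ?thesis
    unfolding is_complex2_def squier_complex_def squier_cells_def Let_def
    by (auto simp: squier_step_def squier_src_def squier_tgt_def epaths_def sedge_start_def
        sedge_end_def F.m_assoc c)
qed

definition squier_lact ::
  "'x set \<Rightarrow> ('x word \<times> 'x word) set \<Rightarrow> 'x word set \<Rightarrow> 'x squier_mor \<Rightarrow> 'x squier_mor" where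
  "squier_lact X R u =
     map_mor (squier_complex X R)
       (\<lambda>v. u \<otimes>\<^bsub>free_group X\<^esub> v) (\<lambda>(p, l, r, q). (u \<otimes>\<^bsub>free_group X\<^esub> p, l, r, q))"

definition squier_ract ::
  "'x set \<Rightarrow> ('x word \<times> 'x word) set \<Rightarrow> 'x squier_mor \<Rightarrow> 'x word set \<Rightarrow> 'x squier_mor" where
  "squier_ract X R \<alpha> v =
     map_mor (squier_complex X R)
       (\<lambda>w. w \<otimes>\<^bsub>free_group X\<^esub> v) (\<lambda>(p, l, r, q). (p, l, r, q \<otimes>\<^bsub>free_group X\<^esub> v)) \<alpha>"

definition squier_op ::
  "'x set \<Rightarrow> ('x word \<times> 'x word) set \<Rightarrow> 'x squier_mor \<Rightarrow> 'x squier_mor \<Rightarrow> 'x squier_mor" where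
  "squier_op X R \<alpha> \<beta> =
     mor_comp (squier_complex X R)
       (squier_ract X R \<alpha> (mor_dom \<beta>)) (squier_lact X R (mor_ran \<alpha>) \<beta>)"

definition squier_conj ::
  "'x set \<Rightarrow> ('x word \<times> 'x word) set \<Rightarrow> 'x squier_mor \<Rightarrow> 'x word set \<Rightarrow> 'x squier_mor" where
  "squier_conj X R \<alpha> q = squier_ract X R (squier_lact X R (inv\<^bsub>free_group X\<^esub> q) \<alpha>) q"

definition squier_star1 ::
  "'x set \<Rightarrow> ('x word \<times> 'x word) set \<Rightarrow> 'x squier_mor monoid" where
  "squier_star1 X R =
     \<lparr>carrier = star (squier_complex X R) \<one>\<^bsub>free_group X\<^esub>,
      mult = squier_op X R,
      one = homotopy_class (squier_complex X R) (\<one>\<^bsub>free_group X\<^esub>, [], \<one>\<^bsub>free_group X\<^esub>)\<rparr>"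


section \<open>Crossed modules\<close>

locale crossed_module =
  T: group T + \<Gamma>: group \<Gamma>
  for T :: "('t, 'm) monoid_scheme" and \<Gamma> :: "('g, 'n) monoid_scheme"
    and bd :: "'t \<Rightarrow> 'g" and act :: "'t \<Rightarrow> 'g \<Rightarrow> 't" +
  assumes boundary_hom: "bd \<in> hom T \<Gamma>"
    and act_auto: "g \<in> carrier \<Gamma> \<Longrightarrow> (\<lambda>t. act t g) \<in> iso T T"
    and act_one: "t \<in> carrier T \<Longrightarrow> act t \<one>\<^bsub>\<Gamma>\<^esub> = t"
    and act_mult: "\<lbrakk>t \<in> carrier T; g \<in> carrier \<Gamma>; h \<in> carrier \<Gamma>\<rbrakk>
      \<Longrightarrow> act t (g \<otimes>\<^bsub>\<Gamma>\<^esub> h) = act (act t g) h"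
    and boundary_act: "\<lbrakk>t \<in> carrier T; g \<in> carrier \<Gamma>\<rbrakk>
      \<Longrightarrow> bd (act t g) = inv\<^bsub>\<Gamma>\<^esub> g \<otimes>\<^bsub>\<Gamma>\<^esub> bd t \<otimes>\<^bsub>\<Gamma>\<^esub> g"
    and act_boundary: "\<lbrakk>t \<in> carrier T; u \<in> carrier T\<rbrakk>
      \<Longrightarrow> act t (bd u) = inv\<^bsub>T\<^esub> u \<otimes>\<^bsub>T\<^esub> t \<otimes>\<^bsub>T\<^esub> u"

end

(*
  The operation * on the groupoid is associative and compatible with ranges because F(X) acts by
  groupoid automorphisms, so star_1 is a group: the inverse of a path p from 1 to g is the reversed
  path translated by g^-1. The crossed module identity t^(ur) = u^-1 t u amounts to
  u * t^(ur) = t * u, which reads u o (t <| ur) = t o (tr |> u). This is the interchange law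
  (p <| qd) o (pr |> q) = (pd |> q) o (p <| qr). For single edges it is exactly a 2-cell of the
  reduced Squier complex, and it passes to inverses and composites of paths by pasting squares.
*)

theory Submission
  imports Defs
begin

section \<open>Homotopy of edge paths\<close>

fun epath_inv :: "('v, 'e) epath \<Rightarrow> ('v, 'e) epath" where
  "epath_inv (u, es, v) = (v, rev (map (\<lambda>(e, b). (e, \<not> b)) es), u)"

lemma epath_comp_assoc: "epath_comp (epath_comp p q) r = epath_comp p (epath_comp q r)"
  by (cases p; cases q; cases r) simp

lemma epath_start_comp [simp]: "epath_start (epath_comp p q) = epath_start p"
  by (cases p; cases q) simp

lemma epath_end_comp [simp]: "epath_end (epath_comp p q) = epath_end q"
  by (cases p; cases q) simp

lemma epath_start_inv [simp]: "epath_start (epath_inv p) = epath_end p"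
  by (cases p) simp

lemma epath_end_inv [simp]: "epath_end (epath_inv p) = epath_start p"
  by (cases p) simp

lemma epath_inv_inv [simp]: "epath_inv (epath_inv p) = p"
  by (cases p) (auto simp: rev_map intro!: map_idI)

lemma epath_comp_empty_left: "epath_start p = u \<Longrightarrow> epath_comp (u, [], w) p = p"
  by (cases p) simp

lemma epath_comp_empty_right: "epath_end p = u \<Longrightarrow> epath_comp p (w, [], u) = p"
  by (cases p) simp

lemma epath_start_map [simp]: "epath_start (map_epath f g p) = f (epath_start p)"
  by (cases p) simp

lemma epath_end_map [simp]: "epath_end (map_epath f g p) = f (epath_end p)"
  by (cases p) simp

lemma map_epath_comp:
  "map_epath f g (epath_comp p q) = epath_comp (map_epath f g p) (map_epath f g q)"
  by (cases p; cases q) simp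

lemma map_epath_inv: "map_epath f g (epath_inv p) = epath_inv (map_epath f g p)"
  by (cases p) (auto simp: rev_map split_def)

lemma map_epath_map_epath:
  "map_epath f g (map_epath f' g' p) = map_epath (\<lambda>v. f (f' v)) (\<lambda>e. g (g' e)) p"
  by (cases p) (auto simp: split_def)

lemma walk_edges: "walk K u es v \<Longrightarrow> fst ` set es \<subseteq> edges K"
  by (induction es arbitrary: u) auto

text \<open>The group laws hold only on the carrier, so two translations need to agree only on the
  vertices and edges of \<open>K\<close>. This reduces the action laws on paths to identities
  between labels.\<close>

lemma map_epath_cong:
  assumes "p \<in> epaths K" "\<And>v. v \<in> verts K \<Longrightarrow> f v = f' v" "\<And>e. e \<in> edges K \<Longrightarrow> g e = g' e"
    and "epath_start p \<in> verts K" "epath_end p \<in> verts K"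
  shows "map_epath f g p = map_epath f' g' p"
proof -
  obtain u es v where p: "p = (u, es, v)" by (cases p)
  have "g e = g' e" if "(e, b) \<in> set es" for e b
    using walk_edges[of K u es v] assms(1,3) p that by (force simp: epaths_def)
  then show ?thesis using assms(2,4,5) p by auto
qed

lemma map_epath_id: "map_epath (\<lambda>v. v) (\<lambda>e. e) p = p"
  by (cases p) (simp add: split_def)

lemma walk_append: "walk K u es v \<Longrightarrow> walk K v es' w \<Longrightarrow> walk K u (es @ es') w"
  by (induction es arbitrary: u) auto

lemma epaths_comp:
  "\<lbrakk>p \<in> epaths K; q \<in> epaths K; epath_end p = epath_start q\<rbrakk> \<Longrightarrow> epath_comp p q \<in> epaths K"
  by (cases p; cases q) (auto simp: epaths_def intro: walk_append)

section \<open>Reversal, cancellation and pasting of homotopies in a 2-complex\<close>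

locale two_complex =
  fixes K :: "('v, 'e) complex2"
  assumes wf: "is_complex2 K"
begin

lemma sedge_verts:
  assumes "fst e \<in> edges K"
  shows "sedge_start K e \<in> verts K" "sedge_end K e \<in> verts K"
  using assms wf by (auto simp: is_complex2_def sedge_start_def sedge_end_def split: prod.splits)

lemma walk_verts: "walk K u es v \<Longrightarrow> u \<in> verts K \<and> v \<in> verts K"
  by (induction es arbitrary: u) auto

lemma epaths_verts: "p \<in> epaths K \<Longrightarrow> epath_start p \<in> verts K \<and> epath_end p \<in> verts K"
  by (cases p) (auto simp: epaths_def dest: walk_verts)

lemma walk_inv: "walk K u es v \<Longrightarrow> walk K v (rev (map (\<lambda>(e, b). (e, \<not> b)) es)) u"
proof (induction es arbitrary: u)
  case Nil
  then show ?case by auto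
next
  case (Cons e es)
  obtain x b where e: "e = (x, b)" by (cases e)
  have "walk K v (rev (map (\<lambda>(e, b). (e, \<not> b)) es)) (sedge_end K e)"
    using Cons by simp
  moreover have "walk K (sedge_end K e) [(x, \<not> b)] u"
    using Cons.prems sedge_verts[of e] e by (auto simp: sedge_start_def sedge_end_def)
  ultimately show ?case using walk_append e by fastforce
qed

lemma epaths_inv: "p \<in> epaths K \<Longrightarrow> epath_inv p \<in> epaths K"
  by (cases p) (auto simp: epaths_def dest: walk_inv)

text \<open>Every generating rule relates parallel paths of \<open>K\<close>; for 2-cells this is
  what \<open>is_complex2\<close> demands. It is the reason why domain and range are well defined on
  homotopy classes.\<close>

lemma homotopic_endpoints:
  assumes "homotopic K p q"
  shows "p \<in> epaths K" "q \<in> epaths K" "epath_start p = epath_start q" "epath_end p = epath_end q"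
proof -
  have "p \<in> epaths K \<and> q \<in> epaths K \<and> epath_start p = epath_start q \<and> epath_end p = epath_end q"
    using assms
  proof induction
    case (cancel e v b)
    then show ?case
      using sedge_verts[of "(e, b)"] sedge_verts[of "(e, \<not> b)"]
      by (auto simp: epaths_def sedge_start_def sedge_end_def)
  next
    case (cell p q)
    then show ?case using wf by (auto simp: is_complex2_def)
  qed (auto intro: epaths_comp)
  then show "p \<in> epaths K" "q \<in> epaths K" "epath_start p = epath_start q"
    "epath_end p = epath_end q" by auto
qed

lemma homotopic_comp_left:
  "\<lbrakk>homotopic K q q'; p \<in> epaths K; epath_end p = epath_start q\<rbrakk>
    \<Longrightarrow> homotopic K (epath_comp p q) (epath_comp p q')"
  by (auto intro: homotopic.comp homotopic.refl)

lemma homotopic_comp_right: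
  "\<lbrakk>homotopic K p p'; q \<in> epaths K; epath_end p = epath_start q\<rbrakk>
    \<Longrightarrow> homotopic K (epath_comp p q) (epath_comp p' q)"
  by (auto intro: homotopic.comp homotopic.refl)

text \<open>Backtracking contracts from the inside out: the induction hypothesis removes the tail
  together with its reversal, and the remaining pair, the first edge and its inverse, is removed by
  \<open>homotopic.cancel\<close>.\<close>

lemma homotopic_inv_right:
  "p \<in> epaths K \<Longrightarrow> homotopic K (epath_comp p (epath_inv p)) (epath_start p, [], epath_start p)"
proof -
  have "homotopic K (epath_comp (u, es, v) (epath_inv (u, es, v))) (u, [], u)"
    if "walk K u es v" for u es v
    using that
  proof (induction es arbitrary: u)
    case Nil
    then show ?case by (auto intro!: homotopic.refl simp: epaths_def)
  next
    case (Cons e es)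
    obtain x b where e: "e = (x, b)" by (cases e)
    let ?w = "sedge_end K e" and ?es' = "rev (map (\<lambda>(e, b). (e, \<not> b)) es)"
    have x: "x \<in> edges K" "u = sedge_start K e" "walk K ?w es v" using Cons.prems e by auto
    have p: "(u, [e], ?w) \<in> epaths K" "(?w, [(x, \<not> b)], u) \<in> epaths K"
      using x e sedge_verts[of e] by (auto simp: epaths_def sedge_start_def sedge_end_def)
    have "homotopic K (?w, es @ ?es', ?w) (?w, [], ?w)" using Cons.IH[OF x(3)] by simp
    then have "homotopic K (epath_comp (?w, es @ ?es', ?w) (?w, [(x, \<not> b)], u))
        (epath_comp (?w, [], ?w) (?w, [(x, \<not> b)], u))"
      using p by (intro homotopic_comp_right) auto
    then have "homotopic K (epath_comp (u, [e], ?w) (epath_comp (?w, es @ ?es', ?w) (?w, [(x, \<not> b)], u)))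
        (epath_comp (u, [e], ?w) (epath_comp (?w, [], ?w) (?w, [(x, \<not> b)], u)))"
      using p by (intro homotopic_comp_left) auto
    then have "homotopic K (epath_comp (u, e # es, v) (epath_inv (u, e # es, v))) (u, [e, (x, \<not> b)], u)"
      by (simp add: e)
    moreover have "homotopic K (u, [e, (x, \<not> b)], u) (u, [], u)"
      unfolding e by (rule homotopic.cancel) (use x e in auto)
    ultimately show ?case by (rule homotopic.trans)
  qed
  then show "p \<in> epaths K \<Longrightarrow> ?thesis" by (cases p) (auto simp: epaths_def simp del: epath_inv.simps)
qed

lemma homotopic_inv_left:
  "p \<in> epaths K \<Longrightarrow> homotopic K (epath_comp (epath_inv p) p) (epath_end p, [], epath_end p)"
  using homotopic_inv_right[of "epath_inv p"] by (simp add: epaths_inv)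

text \<open>A commuting square can be read from another corner. This reflection is what carries the
  interchange law over to reversed paths.\<close>

lemma square_flip:
  assumes h: "homotopic K (epath_comp a b) (epath_comp c d)"
    and p: "a \<in> epaths K" "b \<in> epaths K" "c \<in> epaths K" "d \<in> epaths K"
    and m: "epath_end a = epath_start b" "epath_end c = epath_start d"
  shows "homotopic K (epath_comp d (epath_inv b)) (epath_comp (epath_inv c) a)"
proof -
  let ?c = "epath_inv c" and ?b = "epath_inv b"
  have e: "epath_start a = epath_start c" "epath_end b = epath_end d"
    using homotopic_endpoints(3,4)[OF h] by auto
  note i = epaths_inv epaths_comp
  have "homotopic K (epath_comp (epath_comp ?c c) (epath_comp d ?b))
      (epath_comp (epath_end c, [], epath_end c) (epath_comp d ?b))"
    using p m e by (intro homotopic_comp_right homotopic_inv_left i) auto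
  then have 1: "homotopic K (epath_comp (epath_comp ?c c) (epath_comp d ?b)) (epath_comp d ?b)"
    using m by (simp add: epath_comp_empty_left)
  \<comment> \<open>The given square is composed with \<open>epath_inv c\<close> in front and
    \<open>epath_inv b\<close> behind; facts 1 and 3 contract the backtracks that this creates on
    the two sides.\<close>
  have 2: "homotopic K (epath_comp ?c (epath_comp (epath_comp a b) ?b))
      (epath_comp ?c (epath_comp (epath_comp c d) ?b))"
    using p m e by (intro homotopic_comp_left homotopic_comp_right h i) auto
  have "homotopic K (epath_comp (epath_comp ?c a) (epath_comp b ?b))
      (epath_comp (epath_comp ?c a) (epath_start b, [], epath_start b))"
    using p m e by (intro homotopic_comp_left homotopic_inv_right i) auto
  then have 3: "homotopic K (epath_comp (epath_comp ?c a) (epath_comp b ?b)) (epath_comp ?c a)"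
    using m by (simp add: epath_comp_empty_right)
  show ?thesis
    using 1 2 3 by (metis epath_comp_assoc homotopic.sym homotopic.trans)
qed

section \<open>Homotopy classes as morphisms of the fundamental groupoid\<close>

lemma class_eq_iff:
  "p \<in> epaths K \<Longrightarrow> homotopy_class K p = homotopy_class K q \<longleftrightarrow> homotopic K p q"
  unfolding homotopy_class_def
  by (metis (mono_tags, lifting) Collect_cong homotopic.refl homotopic.sym homotopic.trans mem_Collect_eq)

lemma class_eqI: "homotopic K p q \<Longrightarrow> homotopy_class K p = homotopy_class K q"
  using class_eq_iff homotopic_endpoints(1) by blast

text \<open>Homotopic paths share their start and the class contains \<open>p\<close>, so
  \<open>the_elem\<close> is applied to a singleton.\<close>

lemma mor_dom_class: "p \<in> epaths K \<Longrightarrow> mor_dom (homotopy_class K p) = epath_start p"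
proof -
  assume p: "p \<in> epaths K"
  have "epath_start ` homotopy_class K p = {epath_start p}"
  proof
    show "epath_start ` homotopy_class K p \<subseteq> {epath_start p}"
      using homotopic_endpoints(3)[of p] by (auto simp: homotopy_class_def)
    show "{epath_start p} \<subseteq> epath_start ` homotopy_class K p"
      using homotopic.refl[OF p] by (simp add: homotopy_class_def)
  qed
  then show ?thesis by (simp add: mor_dom_def)
qed

lemma mor_ran_class: "p \<in> epaths K \<Longrightarrow> mor_ran (homotopy_class K p) = epath_end p"
proof -
  assume p: "p \<in> epaths K"
  have "epath_end ` homotopy_class K p = {epath_end p}"
  proof
    show "epath_end ` homotopy_class K p \<subseteq> {epath_end p}"
      using homotopic_endpoints(4)[of p] by (auto simp: homotopy_class_def)
    show "{epath_end p} \<subseteq> epath_end ` homotopy_class K p"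
      using homotopic.refl[OF p] by (simp add: homotopy_class_def)
  qed
  then show ?thesis by (simp add: mor_ran_def)
qed

text \<open>\<open>mor_comp\<close> is a union over all composable representatives. Homotopy is a
  congruence for composition, so all contributing classes coincide, and \<open>p\<close>,
  \<open>q\<close> themselves show that the union is not empty.\<close>

lemma mor_comp_class:
  assumes "p \<in> epaths K" "q \<in> epaths K" "epath_end p = epath_start q"
  shows "mor_comp K (homotopy_class K p) (homotopy_class K q) = homotopy_class K (epath_comp p q)"
proof -
  have "homotopy_class K (epath_comp p' q') = homotopy_class K (epath_comp p q)"
    if "p' \<in> homotopy_class K p" "q' \<in> homotopy_class K q" for p' q'
    using that assms
    by (intro class_eqI[symmetric] homotopic.comp) (auto simp: homotopy_class_def)
  moreover have "p \<in> homotopy_class K p" "q \<in> homotopy_class K q"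
    using assms by (auto simp: homotopy_class_def intro: homotopic.refl)
  ultimately show ?thesis using assms(3) unfolding mor_comp_def by blast
qed

lemma star_eq: "star K v = homotopy_class K ` {p \<in> epaths K. epath_start p = v}"
  by (auto simp: star_def groupoid_mors_def mor_dom_class)

end

section \<open>Cellular self-maps of a 2-complex and their effect on homotopy classes\<close>

locale complex2_endo = two_complex +
  fixes f :: "'a \<Rightarrow> 'a" and g :: "'b \<Rightarrow> 'b"
  assumes verts_map: "v \<in> verts K \<Longrightarrow> f v \<in> verts K"
    and edges_map: "e \<in> edges K \<Longrightarrow> g e \<in> edges K"
    and src_map: "e \<in> edges K \<Longrightarrow> src K (g e) = f (src K e)"
    and tgt_map: "e \<in> edges K \<Longrightarrow> tgt K (g e) = f (tgt K e)"
    and cells_map: "(p, q) \<in> cells K \<Longrightarrow> (map_epath f g p, map_epath f g q) \<in> cells K"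
begin

lemma walk_map: "walk K u es v \<Longrightarrow> walk K (f u) (map (\<lambda>(e, b). (g e, b)) es) (f v)"
  by (induction es arbitrary: u)
    (auto simp: verts_map edges_map sedge_start_def sedge_end_def src_map tgt_map split: if_splits)

lemma epaths_map: "p \<in> epaths K \<Longrightarrow> map_epath f g p \<in> epaths K"
  by (cases p) (auto simp: epaths_def dest: walk_map)

text \<open>Each rule generating homotopy is carried to an instance of the same rule: cells go to
  cells, and backtracks go to backtracks because sources and targets are respected.\<close>

lemma homotopic_map: "homotopic K p q \<Longrightarrow> homotopic K (map_epath f g p) (map_epath f g q)"
proof (induction rule: homotopic.induct)
  case (cancel e v b)
  then have "homotopic K (f v, [(g e, b), (g e, \<not> b)], f v) (f v, [], f v)"
    by (intro homotopic.cancel) (auto simp: edges_map sedge_start_def src_map tgt_map)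
  then show ?case by simp
qed (auto simp: map_epath_comp intro: homotopic.intros epaths_map cells_map)

lemma map_mor_class:
  assumes "p \<in> epaths K"
  shows "map_mor K f g (homotopy_class K p) = homotopy_class K (map_epath f g p)"
proof -
  have "homotopy_class K (map_epath f g q) = homotopy_class K (map_epath f g p)"
    if "q \<in> homotopy_class K p" for q
    using that by (intro class_eqI[symmetric] homotopic_map) (simp add: homotopy_class_def)
  moreover have "p \<in> homotopy_class K p"
    using assms by (simp add: homotopy_class_def homotopic.refl)
  ultimately show ?thesis unfolding map_mor_def by blast
qed

end


section \<open>The actions of the free group on paths\<close>

locale squier =
  fixes X :: "'x set" and R :: "('x word \<times> 'x word) set"
  assumes presentation: "group_presentation X R"
begin

abbreviation "F \<equiv> free_group X"
abbreviation "K \<equiv> squier_complex X R"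

sublocale F: group F by (rule free_group_group)

sublocale two_complex K by unfold_locales (rule squier_complex_wf[OF presentation])

lemma word_class_closed:
  "(l, r) \<in> R \<Longrightarrow> word_class X l \<in> carrier F \<and> word_class X r \<in> carrier F"
  using presentation by (auto simp: group_presentation_def free_group_carrier)

text \<open>The actions on representatives. All later computations take place on paths and are
  transferred to classes by \<open>squier_lact_class\<close> and
  \<open>squier_ract_class\<close>.\<close>

definition lpath where
  "lpath u = map_epath (\<lambda>v. u \<otimes>\<^bsub>F\<^esub> v) (\<lambda>(p, l, r, q). (u \<otimes>\<^bsub>F\<^esub> p, l :: 'x word, r :: 'x word, q :: 'x word set))"

definition rpath where
  "rpath \<alpha> v = map_epath (\<lambda>w. w \<otimes>\<^bsub>F\<^esub> v) (\<lambda>(p :: 'x word set, l :: 'x word, r :: 'x word, q). (p, l, r, q \<otimes>\<^bsub>F\<^esub> v)) \<alpha>"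

lemma verts_K: "verts K = carrier F"
  by (simp add: squier_complex_def)

lemma edges_K: "edges K = {(p, l, r, q). p \<in> carrier F \<and> q \<in> carrier F \<and> (l, r) \<in> R}"
  by (simp add: squier_complex_def)

lemma src_K: "src K = squier_src X"
  by (simp add: squier_complex_def)

lemma tgt_K: "tgt K = squier_tgt X"
  by (simp add: squier_complex_def)

text \<open>The boundary of a single 2-cell, with its parameters exposed so that a translate is
  visibly again a 2-cell: left translation changes only \<open>p\<close>, right translation only
  \<open>q'\<close>.\<close>

definition square where
  "square p l r q p' l' r' q' =
    (epath_comp (squier_step X (p, l, r, q \<otimes>\<^bsub>F\<^esub> p' \<otimes>\<^bsub>F\<^esub> word_class X l' \<otimes>\<^bsub>F\<^esub> q'))
       (squier_step X (p \<otimes>\<^bsub>F\<^esub> word_class X r \<otimes>\<^bsub>F\<^esub> q \<otimes>\<^bsub>F\<^esub> p', l', r', q')),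
     epath_comp (squier_step X (p \<otimes>\<^bsub>F\<^esub> word_class X l \<otimes>\<^bsub>F\<^esub> q \<otimes>\<^bsub>F\<^esub> p', l', r', q'))
       (squier_step X (p, l, r, q \<otimes>\<^bsub>F\<^esub> p' \<otimes>\<^bsub>F\<^esub> word_class X r' \<otimes>\<^bsub>F\<^esub> q')))"

lemma cells_K: "cells K = {square p l r q p' l' r' q' | p q p' q' l r l' r'.
    p \<in> carrier F \<and> q \<in> carrier F \<and> p' \<in> carrier F \<and> q' \<in> carrier F \<and>
    (l, r) \<in> R \<and> (l', r') \<in> R}"
  by (simp add: squier_complex_def squier_cells_def Let_def square_def)

lemma square_in_cells:
  "\<lbrakk>p \<in> carrier F; q \<in> carrier F; p' \<in> carrier F; q' \<in> carrier F; (l, r) \<in> R; (l', r') \<in> R\<rbrakk>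
    \<Longrightarrow> square p l r q p' l' r' q' \<in> cells K"
  unfolding cells_K by blast

lemma lact_endo:
  assumes u: "u \<in> carrier F"
  shows "complex2_endo K (\<lambda>v. u \<otimes>\<^bsub>F\<^esub> v) (\<lambda>(p, l, r, q). (u \<otimes>\<^bsub>F\<^esub> p, l, r, q))"
proof unfold_locales
  fix p q assume "(p, q) \<in> cells K"
  then obtain a b a' b' l r l' r' where
    c: "a \<in> carrier F" "b \<in> carrier F" "a' \<in> carrier F" "b' \<in> carrier F" "(l, r) \<in> R" "(l', r') \<in> R"
    and pq: "(p, q) = square a l r b a' l' r' b'"
    unfolding cells_K by blast
  note w = word_class_closed[OF c(5)] word_class_closed[OF c(6)]
  have "(map_epath (\<lambda>v. u \<otimes>\<^bsub>F\<^esub> v) (\<lambda>(p, l, r, q). (u \<otimes>\<^bsub>F\<^esub> p, l, r, q)) p,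
      map_epath (\<lambda>v. u \<otimes>\<^bsub>F\<^esub> v) (\<lambda>(p, l, r, q). (u \<otimes>\<^bsub>F\<^esub> p, l, r, q)) q)
      = square (u \<otimes>\<^bsub>F\<^esub> a) l r b a' l' r' b'"
    using c w u pq by (simp add: square_def squier_step_def squier_src_def squier_tgt_def F.m_assoc)
  moreover have "square (u \<otimes>\<^bsub>F\<^esub> a) l r b a' l' r' b' \<in> cells K"
    using c u by (intro square_in_cells) auto
  ultimately show "(map_epath (\<lambda>v. u \<otimes>\<^bsub>F\<^esub> v) (\<lambda>(p, l, r, q). (u \<otimes>\<^bsub>F\<^esub> p, l, r, q)) p,
      map_epath (\<lambda>v. u \<otimes>\<^bsub>F\<^esub> v) (\<lambda>(p, l, r, q). (u \<otimes>\<^bsub>F\<^esub> p, l, r, q)) q) \<in> cells K"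
    by simp
qed (use u word_class_closed in \<open>auto simp: verts_K edges_K src_K tgt_K squier_src_def
    squier_tgt_def F.m_assoc\<close>)

lemma ract_endo:
  assumes u: "u \<in> carrier F"
  shows "complex2_endo K (\<lambda>v. v \<otimes>\<^bsub>F\<^esub> u) (\<lambda>(p, l, r, q). (p, l, r, q \<otimes>\<^bsub>F\<^esub> u))"
proof unfold_locales
  fix p q assume "(p, q) \<in> cells K"
  then obtain a b a' b' l r l' r' where
    c: "a \<in> carrier F" "b \<in> carrier F" "a' \<in> carrier F" "b' \<in> carrier F" "(l, r) \<in> R" "(l', r') \<in> R"
    and pq: "(p, q) = square a l r b a' l' r' b'"
    unfolding cells_K by blast
  note w = word_class_closed[OF c(5)] word_class_closed[OF c(6)]
  have "(map_epath (\<lambda>v. v \<otimes>\<^bsub>F\<^esub> u) (\<lambda>(p, l, r, q). (p, l, r, q \<otimes>\<^bsub>F\<^esub> u)) p,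
      map_epath (\<lambda>v. v \<otimes>\<^bsub>F\<^esub> u) (\<lambda>(p, l, r, q). (p, l, r, q \<otimes>\<^bsub>F\<^esub> u)) q)
      = square a l r b a' l' r' (b' \<otimes>\<^bsub>F\<^esub> u)"
    using c w u pq by (simp add: square_def squier_step_def squier_src_def squier_tgt_def F.m_assoc)
  moreover have "square a l r b a' l' r' (b' \<otimes>\<^bsub>F\<^esub> u) \<in> cells K"
    using c u by (intro square_in_cells) auto
  ultimately show "(map_epath (\<lambda>v. v \<otimes>\<^bsub>F\<^esub> u) (\<lambda>(p, l, r, q). (p, l, r, q \<otimes>\<^bsub>F\<^esub> u)) p,
      map_epath (\<lambda>v. v \<otimes>\<^bsub>F\<^esub> u) (\<lambda>(p, l, r, q). (p, l, r, q \<otimes>\<^bsub>F\<^esub> u)) q) \<in> cells K"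
    by simp
qed (use u word_class_closed in \<open>auto simp: verts_K edges_K src_K tgt_K squier_src_def
    squier_tgt_def F.m_assoc\<close>)

lemma epath_start_lpath [simp]: "epath_start (lpath u p) = u \<otimes>\<^bsub>F\<^esub> epath_start p"
  and epath_end_lpath [simp]: "epath_end (lpath u p) = u \<otimes>\<^bsub>F\<^esub> epath_end p"
  and epath_start_rpath [simp]: "epath_start (rpath p u) = epath_start p \<otimes>\<^bsub>F\<^esub> u"
  and epath_end_rpath [simp]: "epath_end (rpath p u) = epath_end p \<otimes>\<^bsub>F\<^esub> u"
  by (auto simp: lpath_def rpath_def)

lemma lpath_comp: "lpath u (epath_comp p q) = epath_comp (lpath u p) (lpath u q)"
  and rpath_comp: "rpath (epath_comp p q) u = epath_comp (rpath p u) (rpath q u)"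
  by (auto simp: lpath_def rpath_def map_epath_comp)

lemma lpath_inv: "lpath u (epath_inv p) = epath_inv (lpath u p)"
  and rpath_inv: "rpath (epath_inv p) u = epath_inv (rpath p u)"
  by (auto simp: lpath_def rpath_def map_epath_inv)

lemma lpath_empty [simp]: "lpath u (v, [], w) = (u \<otimes>\<^bsub>F\<^esub> v, [], u \<otimes>\<^bsub>F\<^esub> w)"
  and rpath_empty [simp]: "rpath (v, [], w) u = (v \<otimes>\<^bsub>F\<^esub> u, [], w \<otimes>\<^bsub>F\<^esub> u)"
  by (auto simp: lpath_def rpath_def)

lemma lpath_closed [intro]: "u \<in> carrier F \<Longrightarrow> p \<in> epaths K \<Longrightarrow> lpath u p \<in> epaths K"
  unfolding lpath_def by (rule complex2_endo.epaths_map[OF lact_endo])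

lemma rpath_closed [intro]: "u \<in> carrier F \<Longrightarrow> p \<in> epaths K \<Longrightarrow> rpath p u \<in> epaths K"
  unfolding rpath_def by (rule complex2_endo.epaths_map[OF ract_endo])

lemma homotopic_lpath: "u \<in> carrier F \<Longrightarrow> homotopic K p q \<Longrightarrow> homotopic K (lpath u p) (lpath u q)"
  unfolding lpath_def by (rule complex2_endo.homotopic_map[OF lact_endo])

lemma epath_start_closed [simp, intro]: "p \<in> epaths K \<Longrightarrow> epath_start p \<in> carrier F"
  and epath_end_closed [simp, intro]: "p \<in> epaths K \<Longrightarrow> epath_end p \<in> carrier F"
  using epaths_verts verts_K by auto

section \<open>Laws of the two commuting actions on paths\<close>

lemma lpath_mult:
  assumes "p \<in> epaths K" "u \<in> carrier F" "v \<in> carrier F"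
  shows "lpath (u \<otimes>\<^bsub>F\<^esub> v) p = lpath u (lpath v p)"
  unfolding lpath_def map_epath_map_epath
  using assms by (intro map_epath_cong[of _ K]) (auto simp: verts_K edges_K F.m_assoc)

lemma rpath_mult:
  assumes "p \<in> epaths K" "u \<in> carrier F" "v \<in> carrier F"
  shows "rpath p (u \<otimes>\<^bsub>F\<^esub> v) = rpath (rpath p u) v"
  unfolding rpath_def map_epath_map_epath
  using assms by (intro map_epath_cong[of _ K]) (auto simp: verts_K edges_K F.m_assoc)

lemma lpath_rpath:
  assumes "p \<in> epaths K" "u \<in> carrier F" "v \<in> carrier F"
  shows "lpath u (rpath p v) = rpath (lpath u p) v"
  unfolding rpath_def lpath_def map_epath_map_epath
  using assms by (intro map_epath_cong[of _ K]) (auto simp: verts_K edges_K F.m_assoc)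

lemma lpath_one: "p \<in> epaths K \<Longrightarrow> lpath \<one>\<^bsub>F\<^esub> p = p"
  \<comment> \<open>The right-hand \<open>p\<close> is written as its image under the identity map,
    so that \<open>map_epath_cong\<close> can compare multiplication by 1 with the identity on
    labels.\<close>
  by (subst (2) map_epath_id[of p, symmetric], unfold lpath_def, intro map_epath_cong[of _ K])
    (auto simp: verts_K edges_K)

lemma rpath_one: "p \<in> epaths K \<Longrightarrow> rpath p \<one>\<^bsub>F\<^esub> = p"
  by (subst (2) map_epath_id[of p, symmetric], unfold rpath_def, intro map_epath_cong[of _ K])
    (auto simp: verts_K edges_K)

lemma squier_lact_class:
  "u \<in> carrier F \<Longrightarrow> p \<in> epaths K \<Longrightarrow>
    squier_lact X R u (homotopy_class K p) = homotopy_class K (lpath u p)"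
  unfolding squier_lact_def lpath_def by (rule complex2_endo.map_mor_class[OF lact_endo])

lemma squier_ract_class:
  "u \<in> carrier F \<Longrightarrow> p \<in> epaths K \<Longrightarrow>
    squier_ract X R (homotopy_class K p) u = homotopy_class K (rpath p u)"
  unfolding squier_ract_def rpath_def by (rule complex2_endo.map_mor_class[OF ract_endo])


section \<open>The interchange law\<close>

text \<open>The first path represents the operation * applied to the classes of \<open>p\<close> and
  \<open>q\<close>; the second goes round the other two sides of the same rectangle.\<close>

definition interchange where
  "interchange p q \<longleftrightarrow> homotopic K
     (epath_comp (rpath p (epath_start q)) (lpath (epath_end p) q))
     (epath_comp (lpath (epath_start p) q) (rpath p (epath_end q)))"

lemma step_closed: "e \<in> edges K \<Longrightarrow> squier_step X e \<in> epaths K"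
  using sedge_verts[of "(e, True)"] sedge_verts[of "(e, False)"]
  by (auto simp: epaths_def squier_step_def sedge_start_def sedge_end_def src_K tgt_K)

text \<open>In the 2-cell, q p' l' q' is \<open>q\<close> times the source of \<open>e'\<close>, and
  p r q p' is the target of \<open>e\<close> times \<open>p'\<close>; likewise for the other two
  edges. Up to associativity its boundary is therefore the interchange rectangle of \<open>e\<close>
  and \<open>e'\<close>.\<close>

lemma interchange_step:
  assumes "e \<in> edges K" "e' \<in> edges K"
  shows "interchange (squier_step X e) (squier_step X e')"
proof -
  obtain p l r q p' l' r' q' where e: "e = (p, l, r, q)" "e' = (p', l', r', q')"
    by (cases e; cases e')
  have c: "p \<in> carrier F" "q \<in> carrier F" "p' \<in> carrier F" "q' \<in> carrier F"
    "(l, r) \<in> R" "(l', r') \<in> R" using assms e by (auto simp: edges_K)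
  note w = word_class_closed[OF c(5)] word_class_closed[OF c(6)]
  have "square p l r q p' l' r' q' =
     (epath_comp (rpath (squier_step X e) (squier_src X e')) (lpath (squier_tgt X e) (squier_step X e')),
      epath_comp (lpath (squier_src X e) (squier_step X e')) (rpath (squier_step X e) (squier_tgt X e')))"
    using c w
    by (simp add: e square_def squier_step_def squier_src_def squier_tgt_def F.m_assoc lpath_def rpath_def)
  then show ?thesis
    using square_in_cells[OF c(1-6)] homotopic.cell
    unfolding interchange_def by (simp add: squier_step_def)
qed

text \<open>Reversing \<open>q\<close> swaps its end points and so reflects the rectangle, which is
  the reading given by \<open>square_flip\<close>.\<close>

lemma interchange_inv_right:
  assumes "interchange p q" "p \<in> epaths K" "q \<in> epaths K"
  shows "interchange p (epath_inv q)"
  using square_flip[OF assms(1)[unfolded interchange_def]] assms(2,3)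
  by (auto simp: interchange_def lpath_inv rpath_inv)

lemma interchange_inv_left:
  assumes "interchange p q" "p \<in> epaths K" "q \<in> epaths K"
  shows "interchange (epath_inv p) q"
  \<comment> \<open>Applying symmetry first exchanges the roles of \<open>p\<close> and
    \<open>q\<close> in the rectangle; the flipped homotopy then comes out with its sides swapped,
    hence the second use of symmetry.\<close>
  using square_flip[OF homotopic.sym[OF assms(1)[unfolded interchange_def]]] assms(2,3)
  by (auto simp: interchange_def lpath_inv rpath_inv intro: homotopic.sym)

text \<open>Two rectangles are glued along their common side, the translate of \<open>p\<close> by
  the vertex where \<open>q\<close> ends and \<open>q'\<close> starts.\<close>

lemma interchange_comp_right:
  assumes "interchange p q" "interchange p q'"
    and e: "p \<in> epaths K" "q \<in> epaths K" "q' \<in> epaths K" "epath_end q = epath_start q'"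
  shows "interchange p (epath_comp q q')"
proof -
  have "homotopic K
     (epath_comp (epath_comp (rpath p (epath_start q)) (lpath (epath_end p) q)) (lpath (epath_end p) q'))
     (epath_comp (epath_comp (lpath (epath_start p) q) (rpath p (epath_end q))) (lpath (epath_end p) q'))"
    using assms by (intro homotopic_comp_right) (auto simp: interchange_def)
  moreover have "homotopic K
     (epath_comp (lpath (epath_start p) q) (epath_comp (rpath p (epath_start q')) (lpath (epath_end p) q')))
     (epath_comp (lpath (epath_start p) q) (epath_comp (lpath (epath_start p) q') (rpath p (epath_end q'))))"
    using assms by (intro homotopic_comp_left) (auto simp: interchange_def)
  ultimately show ?thesis
    using e(4) by (simp add: interchange_def lpath_comp epath_comp_assoc) (erule homotopic.trans)
qed

text \<open>Here the common side is the translate of \<open>q\<close> by the vertex where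
  \<open>p\<close> ends and \<open>p'\<close> starts.\<close>

lemma interchange_comp_left:
  assumes "interchange p q" "interchange p' q"
    and e: "p \<in> epaths K" "p' \<in> epaths K" "q \<in> epaths K" "epath_end p = epath_start p'"
  shows "interchange (epath_comp p p') q"
proof -
  have "homotopic K
     (epath_comp (rpath p (epath_start q)) (epath_comp (rpath p' (epath_start q)) (lpath (epath_end p') q)))
     (epath_comp (rpath p (epath_start q)) (epath_comp (lpath (epath_start p') q) (rpath p' (epath_end q))))"
    using assms by (intro homotopic_comp_left) (auto simp: interchange_def)
  moreover have "homotopic K
     (epath_comp (epath_comp (rpath p (epath_start q)) (lpath (epath_end p) q)) (rpath p' (epath_end q)))
     (epath_comp (epath_comp (lpath (epath_start p) q) (rpath p (epath_end q))) (rpath p' (epath_end q)))"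
    using assms by (intro homotopic_comp_right) (auto simp: interchange_def)
  ultimately show ?thesis
    using e(4) by (simp add: interchange_def rpath_comp epath_comp_assoc) (erule homotopic.trans)
qed

lemma interchange_empty_left:
  assumes "u \<in> carrier F" "q \<in> epaths K"
  shows "interchange (u, [], u) q"
  using assms by (auto simp: interchange_def epath_comp_empty_left epath_comp_empty_right
      intro!: homotopic.refl)

lemma interchange_empty_right:
  assumes "u \<in> carrier F" "p \<in> epaths K"
  shows "interchange p (u, [], u)"
  using assms by (auto simp: interchange_def epath_comp_empty_left epath_comp_empty_right
      intro!: homotopic.refl)

text \<open>A backward edge is the reversal of a forward one, so empty paths and forward edges
  generate all edge paths under reversal and composition. Closure properties of the interchange law
  thus suffice.\<close>

lemma epath_induct [consumes 1, case_names empty step inv comp]: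
  assumes "p \<in> epaths K"
    and "\<And>u. u \<in> carrier F \<Longrightarrow> P (u, [], u)"
    and "\<And>e. e \<in> edges K \<Longrightarrow> P (squier_step X e)"
    and "\<And>p. p \<in> epaths K \<Longrightarrow> P p \<Longrightarrow> P (epath_inv p)"
    and "\<And>p q. p \<in> epaths K \<Longrightarrow> q \<in> epaths K \<Longrightarrow> epath_end p = epath_start q \<Longrightarrow> P p \<Longrightarrow> P q
      \<Longrightarrow> P (epath_comp p q)"
  shows "P p"
proof -
  have "P (u, es, v)" if "walk K u es v" for u es v
    using that
  proof (induction es arbitrary: u)
    case Nil
    then show ?case using assms(2) by (auto simp: verts_K)
  next
    case (Cons e es)
    obtain x b where e: "e = (x, b)" by (cases e)
    have x: "x \<in> edges K" "u = sedge_start K e" "walk K (sedge_end K e) es v"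
      using Cons.prems e by auto
    have "(u, [e], sedge_end K e) = (if b then squier_step X x else epath_inv (squier_step X x))"
      using x e by (auto simp: squier_step_def sedge_start_def sedge_end_def src_K tgt_K)
    then have "P (u, [e], sedge_end K e)" "(u, [e], sedge_end K e) \<in> epaths K"
      using x assms(3,4) step_closed epaths_inv by auto
    moreover have "P (sedge_end K e, es, v)" "(sedge_end K e, es, v) \<in> epaths K"
      using x Cons.IH by (auto simp: epaths_def)
    ultimately have "P (epath_comp (u, [e], sedge_end K e) (sedge_end K e, es, v))"
      by (intro assms(5)) auto
    then show ?case by simp
  qed
  then show ?thesis using assms(1) by (cases p) (auto simp: epaths_def)
qed

lemma interchange:
  assumes "p \<in> epaths K" "q \<in> epaths K"
  shows "interchange p q"
  using assms(1)
proof (induction p rule: epath_induct)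
  case (step e)
  \<comment> \<open>Only for \<open>p\<close> a single edge must \<open>q\<close> be decomposed as
    well; the other cases of the outer induction keep \<open>q\<close> fixed.\<close>
  show ?case using assms(2)
  proof (induction q rule: epath_induct)
    case (step e')
    then show ?case using interchange_step \<open>e \<in> edges K\<close> by blast
  qed (blast intro: step_closed[OF \<open>e \<in> edges K\<close>] interchange_empty_right interchange_inv_right
      interchange_comp_right)+
qed (blast intro: assms(2) interchange_empty_left interchange_inv_left interchange_comp_left)+


section \<open>The crossed module\<close>

abbreviation "T \<equiv> squier_star1 X R"

lemma star1_carrier: "carrier T = homotopy_class K ` {p \<in> epaths K. epath_start p = \<one>\<^bsub>F\<^esub>}"
  by (simp add: squier_star1_def star_eq)

lemma star1_cases:
  assumes "t \<in> carrier T"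
  obtains p where "p \<in> epaths K" "epath_start p = \<one>\<^bsub>F\<^esub>" "t = homotopy_class K p"
  using assms unfolding star1_carrier by blast

lemma mor_ran_closed: "t \<in> carrier T \<Longrightarrow> mor_ran t \<in> carrier F"
  by (erule star1_cases) (simp add: mor_ran_class)

lemma star1_one: "\<one>\<^bsub>T\<^esub> = homotopy_class K (\<one>\<^bsub>F\<^esub>, [], \<one>\<^bsub>F\<^esub>)"
  by (simp add: squier_star1_def)

lemma empty_closed: "u \<in> carrier F \<Longrightarrow> (u, [], u) \<in> epaths K"
  by (simp add: epaths_def verts_K)

text \<open>Since \<open>q\<close> starts at 1, the right translation of \<open>p\<close> in the
  operation * is trivial, and only the left translation of \<open>q\<close> remains.\<close>

lemma star1_mult:
  assumes "p \<in> epaths K" "epath_start p = \<one>\<^bsub>F\<^esub>" "q \<in> epaths K" "epath_start q = \<one>\<^bsub>F\<^esub>"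
  shows "homotopy_class K p \<otimes>\<^bsub>T\<^esub> homotopy_class K q
    = homotopy_class K (epath_comp p (lpath (epath_end p) q))"
  using assms by (simp add: squier_star1_def squier_op_def mor_dom_class mor_ran_class
      squier_lact_class squier_ract_class rpath_one epath_end_closed mor_comp_class lpath_closed)

lemma star1_group: "group T"
proof (rule groupI)
  show "\<one>\<^bsub>T\<^esub> \<in> carrier T"
    by (auto simp: star1_one star1_carrier empty_closed)
next
  fix x y assume "x \<in> carrier T" "y \<in> carrier T"
  then obtain p q where
    p: "p \<in> epaths K" "epath_start p = \<one>\<^bsub>F\<^esub>" "x = homotopy_class K p" and
    q: "q \<in> epaths K" "epath_start q = \<one>\<^bsub>F\<^esub>" "y = homotopy_class K q"
    by (auto simp: star1_carrier)
  have "epath_comp p (lpath (epath_end p) q) \<in> epaths K"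
    using p q by (intro epaths_comp) auto
  then show "x \<otimes>\<^bsub>T\<^esub> y \<in> carrier T" using p q by (auto simp: star1_mult star1_carrier)
next
  fix x y z assume "x \<in> carrier T" "y \<in> carrier T" "z \<in> carrier T"
  then obtain p q r where
    p: "p \<in> epaths K" "epath_start p = \<one>\<^bsub>F\<^esub>" "x = homotopy_class K p" and
    q: "q \<in> epaths K" "epath_start q = \<one>\<^bsub>F\<^esub>" "y = homotopy_class K q" and
    r: "r \<in> epaths K" "epath_start r = \<one>\<^bsub>F\<^esub>" "z = homotopy_class K r"
    by (auto simp: star1_carrier)
  have "epath_comp p (lpath (epath_end p) q) \<in> epaths K"
    "epath_comp q (lpath (epath_end q) r) \<in> epaths K"
    using p q r by (auto intro!: epaths_comp)
  \<comment> \<open>Both bracketings are represented by literally the same path, because translating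
    by a product is translating twice.\<close>
  then show "x \<otimes>\<^bsub>T\<^esub> y \<otimes>\<^bsub>T\<^esub> z = x \<otimes>\<^bsub>T\<^esub> (y \<otimes>\<^bsub>T\<^esub> z)"
    using p q r by (simp add: star1_mult lpath_mult epath_end_closed lpath_comp epath_comp_assoc)
next
  fix x assume "x \<in> carrier T"
  then obtain p where p: "p \<in> epaths K" "epath_start p = \<one>\<^bsub>F\<^esub>" "x = homotopy_class K p"
    by (auto simp: star1_carrier)
  then show "\<one>\<^bsub>T\<^esub> \<otimes>\<^bsub>T\<^esub> x = x"
    by (simp add: star1_one star1_mult empty_closed lpath_one epath_comp_empty_left)
  define u where "u = inv\<^bsub>F\<^esub> (epath_end p)"
  have u: "u \<in> carrier F" "u \<otimes>\<^bsub>F\<^esub> epath_end p = \<one>\<^bsub>F\<^esub>" using p by (auto simp: u_def epath_end_closed)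
  have c: "lpath u (epath_inv p) \<in> epaths K" using p u by (simp add: lpath_closed epaths_inv)
  have "homotopic K (lpath u (epath_comp (epath_inv p) p))
      (lpath u (epath_end p, [], epath_end p))"
    using p u by (intro homotopic_lpath homotopic_inv_left)
  then have "homotopy_class K (epath_comp (lpath u (epath_inv p)) (lpath u p)) = \<one>\<^bsub>T\<^esub>"
    using u by (simp add: lpath_comp star1_one class_eqI)
  \<comment> \<open>The candidate inverse ends at \<open>u\<close>, since \<open>p\<close> starts at
    1. Hence the product translates \<open>p\<close> by this same \<open>u\<close>, which gives the
    contractible path above.\<close>
  then have "homotopy_class K (lpath u (epath_inv p)) \<otimes>\<^bsub>T\<^esub> x = \<one>\<^bsub>T\<^esub>"
    using p u c by (simp add: star1_mult)
  moreover have "homotopy_class K (lpath u (epath_inv p)) \<in> carrier T"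
    using c u by (auto simp: star1_carrier)
  ultimately show "\<exists>y\<in>carrier T. y \<otimes>\<^bsub>T\<^esub> x = \<one>\<^bsub>T\<^esub>" by blast
qed

section \<open>The conjugation action of F(X) and the crossed module axioms\<close>

definition cpath where "cpath p g = rpath (lpath (inv\<^bsub>F\<^esub> g) p) g"

lemma cpath_closed: "p \<in> epaths K \<Longrightarrow> g \<in> carrier F \<Longrightarrow> cpath p g \<in> epaths K"
  by (auto simp: cpath_def)

lemma epath_start_cpath:
  "epath_start p = \<one>\<^bsub>F\<^esub> \<Longrightarrow> g \<in> carrier F \<Longrightarrow> epath_start (cpath p g) = \<one>\<^bsub>F\<^esub>"
  by (simp add: cpath_def)

lemma epath_end_cpath: "epath_end (cpath p g) = inv\<^bsub>F\<^esub> g \<otimes>\<^bsub>F\<^esub> epath_end p \<otimes>\<^bsub>F\<^esub> g"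
  by (simp add: cpath_def)

lemma conj_class:
  "p \<in> epaths K \<Longrightarrow> g \<in> carrier F \<Longrightarrow>
    squier_conj X R (homotopy_class K p) g = homotopy_class K (cpath p g)"
  by (simp add: squier_conj_def cpath_def squier_lact_class squier_ract_class lpath_closed)

lemma conj_closed: "t \<in> carrier T \<Longrightarrow> g \<in> carrier F \<Longrightarrow> squier_conj X R t g \<in> carrier T"
  by (auto simp: star1_carrier conj_class cpath_closed epath_start_cpath)

lemma conj_one: "t \<in> carrier T \<Longrightarrow> squier_conj X R t \<one>\<^bsub>F\<^esub> = t"
  by (erule star1_cases) (simp add: conj_class cpath_def lpath_one rpath_one)

text \<open>The inverse of g h is h^-1 g^-1, and the left translation by h^-1 moves past the right
  translation by g because the two actions commute.\<close>

lemma conj_conj: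
  "t \<in> carrier T \<Longrightarrow> g \<in> carrier F \<Longrightarrow> h \<in> carrier F \<Longrightarrow>
    squier_conj X R t (g \<otimes>\<^bsub>F\<^esub> h) = squier_conj X R (squier_conj X R t g) h"
  by (erule star1_cases)
    (simp add: conj_class cpath_closed, simp add: cpath_def F.inv_mult_group lpath_mult rpath_mult
      lpath_rpath lpath_closed rpath_closed)

lemma conj_mult:
  assumes "s \<in> carrier T" "t \<in> carrier T" "g \<in> carrier F"
  shows "squier_conj X R (s \<otimes>\<^bsub>T\<^esub> t) g = squier_conj X R s g \<otimes>\<^bsub>T\<^esub> squier_conj X R t g"
proof -
  obtain p q where
    p: "p \<in> epaths K" "epath_start p = \<one>\<^bsub>F\<^esub>" "s = homotopy_class K p" and
    q: "q \<in> epaths K" "epath_start q = \<one>\<^bsub>F\<^esub>" "t = homotopy_class K q"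
    using assms by (auto simp: star1_carrier)
  let ?h = "inv\<^bsub>F\<^esub> g" and ?e = "epath_end p"
  have c: "epath_comp p (lpath ?e q) \<in> epaths K" using p q by (auto intro!: epaths_comp)
  have e: "?e \<in> carrier F" using p by auto
  \<comment> \<open>The conjugate of \<open>p\<close> ends at g^-1 e g, which is the translation
    that the product applies to the conjugate of \<open>q\<close>; the factor g there cancels
    against the g^-1 of that conjugate.\<close>
  have "lpath (?h \<otimes>\<^bsub>F\<^esub> ?e \<otimes>\<^bsub>F\<^esub> g) (cpath q g) = rpath (lpath (?h \<otimes>\<^bsub>F\<^esub> ?e \<otimes>\<^bsub>F\<^esub> g \<otimes>\<^bsub>F\<^esub> ?h) q) g"
    using assms(3) q e by (simp add: cpath_def lpath_rpath lpath_mult lpath_closed)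
  also have "\<dots> = rpath (lpath ?h (lpath ?e q)) g"
    using assms(3) q e by (simp add: F.m_assoc lpath_mult)
  finally have "cpath (epath_comp p (lpath ?e q)) g
      = epath_comp (cpath p g) (lpath (epath_end (cpath p g)) (cpath q g))"
    by (simp add: epath_end_cpath) (simp add: cpath_def lpath_comp rpath_comp)
  then show ?thesis
    using p q assms(3) c
    by (simp add: star1_mult conj_class cpath_closed epath_start_cpath)
qed

text \<open>The second crossed module identity multiplied by \<open>u\<close> on the left, so that
  both sides have explicit representatives and no inverse in \<open>T\<close> is needed.\<close>

lemma peiffer:
  assumes "t \<in> carrier T" "u \<in> carrier T"
  shows "u \<otimes>\<^bsub>T\<^esub> squier_conj X R t (mor_ran u) = t \<otimes>\<^bsub>T\<^esub> u"
proof -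
  obtain p q where
    p: "p \<in> epaths K" "epath_start p = \<one>\<^bsub>F\<^esub>" "t = homotopy_class K p" and
    q: "q \<in> epaths K" "epath_start q = \<one>\<^bsub>F\<^esub>" "u = homotopy_class K q"
    using assms by (auto simp: star1_carrier)
  let ?g = "epath_end q"
  have g: "?g \<in> carrier F" using q by auto
  \<comment> \<open>As second factor after \<open>q\<close>, the conjugate of \<open>p\<close> is
    translated by the end of \<open>q\<close>. This cancels the inverse in the conjugation and
    leaves a pure right translate of \<open>p\<close>.\<close>
  have "lpath ?g (cpath p ?g) = rpath (lpath (?g \<otimes>\<^bsub>F\<^esub> inv\<^bsub>F\<^esub> ?g) p) ?g"
    unfolding cpath_def lpath_mult[OF p(1) g F.inv_closed[OF g]]
    using p g by (simp add: lpath_rpath lpath_closed)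
  then have eq: "lpath ?g (cpath p ?g) = rpath p ?g"
    using p g by (simp add: lpath_one)
  have "interchange p q" using p q interchange by blast
  \<comment> \<open>Both paths start at 1, so the two translations by start points in the
    interchange law vanish.\<close>
  then have "homotopic K (epath_comp p (lpath (epath_end p) q)) (epath_comp q (rpath p ?g))"
    using p q by (simp add: interchange_def lpath_one rpath_one)
  then show ?thesis
    using p q g eq class_eqI
    by (simp add: star1_mult conj_class mor_ran_class cpath_closed epath_start_cpath)
qed

lemma star1_crossed_module: "crossed_module T F mor_ran (squier_conj X R)"
proof -
  interpret T: group T by (rule star1_group)
  show ?thesis
  proof unfold_locales
    show "mor_ran \<in> hom T F"
    proof (rule homI)
      fix x y assume "x \<in> carrier T" "y \<in> carrier T"
      then obtain p q where
        p: "p \<in> epaths K" "epath_start p = \<one>\<^bsub>F\<^esub>" "x = homotopy_class K p" and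
        q: "q \<in> epaths K" "epath_start q = \<one>\<^bsub>F\<^esub>" "y = homotopy_class K q"
        by (auto simp: star1_carrier)
      have "epath_comp p (lpath (epath_end p) q) \<in> epaths K"
        using p q by (auto intro!: epaths_comp)
      then show "mor_ran (x \<otimes>\<^bsub>T\<^esub> y) = mor_ran x \<otimes>\<^bsub>F\<^esub> mor_ran y"
        using p q by (simp add: star1_mult mor_ran_class)
    qed (rule mor_ran_closed)
  next
    fix g assume g: "g \<in> carrier F"
    have "bij_betw (\<lambda>t. squier_conj X R t g) (carrier T) (carrier T)"
    proof (rule bij_betw_byWitness[where f' = "\<lambda>t. squier_conj X R t (inv\<^bsub>F\<^esub> g)"])
      show "\<forall>t\<in>carrier T. squier_conj X R (squier_conj X R t g) (inv\<^bsub>F\<^esub> g) = t"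
        "\<forall>t\<in>carrier T. squier_conj X R (squier_conj X R t (inv\<^bsub>F\<^esub> g)) g = t"
        using g by (auto simp: conj_conj[symmetric] conj_one)
    qed (use g conj_closed in auto)
    then show "(\<lambda>t. squier_conj X R t g) \<in> iso T T"
      using g by (auto simp: iso_def conj_mult conj_closed intro!: homI)
  next
    fix t g assume "t \<in> carrier T" "g \<in> carrier F"
    then show "mor_ran (squier_conj X R t g) = inv\<^bsub>F\<^esub> g \<otimes>\<^bsub>F\<^esub> mor_ran t \<otimes>\<^bsub>F\<^esub> g"
      by (auto simp: star1_carrier conj_class mor_ran_class cpath_closed epath_end_cpath)
  next
    fix t u assume tu: "t \<in> carrier T" "u \<in> carrier T"
    then have "squier_conj X R t (mor_ran u) \<in> carrier T" by (intro conj_closed mor_ran_closed)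
    then show "squier_conj X R t (mor_ran u) = inv\<^bsub>T\<^esub> u \<otimes>\<^bsub>T\<^esub> t \<otimes>\<^bsub>T\<^esub> u"
      using peiffer[OF tu] tu by (simp add: T.m_assoc T.inv_solve_left)
  qed (auto simp: conj_one conj_conj)
qed

end

theorem corollary3p3:
  fixes X :: "'x set" and R :: "('x word \<times> 'x word) set"
  assumes "group_presentation X R"
  shows "group (squier_star1 X R) \<and>
    crossed_module (squier_star1 X R) (free_group X) mor_ran (squier_conj X R)"
proof -
  interpret squier X R by (rule squier.intro[OF assms])
  show ?thesis using star1_group star1_crossed_module by blast
qed

end
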